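(* Let $G=(V,E)$ be a finite connected graph with $n=|V|$ vertices, and let $\mu_n\le \mu_{n-1}\le\dots\le\mu_2\le\mu_1$ be the eigenvalues of its normalized adjacency matrix $D^{-1}A$, listed with multiplicity. Let $h$ be the edge-expansion of $G$. Then $$1+\mu_{n-1}\geq \frac{(1-\mu_2)^2}{2h^2}\left(\sqrt{1+\frac{h^2}{1-\mu_2}}-1\right)^2.$$
   Context: Graphs are finite, simple and undirected, without isolated vertices (so a graph has at least two vertices). $d_u$ denotes the degree of vertex $u$; $D$ is the diagonal degree matrix, $A$ the adjacency matrix ($A_{ij}=1$ if $\{i,j\}\in E$, else $0$). The eigenvalues of $D^{-1}A$ are real; $\mu_1=1$, and $\mu_2<1$ when $G$ is connected. For $S\subset V$, $\mathrm{vol}(S)=\sum_{i\in S}d_i$ and $\partial S=\{\{i,j\}\in E: i\in S, j\notin S\}$; $h(S)=|\partial S|/\min(\mathrm{vol}(S),\mathrm{vol}(V\setminus S))$, and the edge-expansion (Cheeger constant) is $h=\min_{\emptyset\ne S\subsetneq V} h(S)$, which is positive when $G$ is connected. *)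

theory Defs
  imports Complex_Main "Jordan_Normal_Form.Char_Poly"
begin

section \<open>Finite simple graphs without isolated vertices\<close>

text \<open>A graph is given by its vertex set and its set of edges; an edge is an unordered pair, that
  is, a two-element set of vertices.\<close>

definition vertex_degree :: "'a set set \<Rightarrow> 'a \<Rightarrow> nat" where
  "vertex_degree E u = card {e \<in> E. u \<in> e}"

definition simple_graph :: "'a set \<Rightarrow> 'a set set \<Rightarrow> bool" where
  "simple_graph V E \<longleftrightarrow>
     finite V \<and> V \<noteq> {} \<and> (\<forall>e\<in>E. e \<subseteq> V \<and> card e = 2) \<and> (\<forall>u\<in>V. vertex_degree E u \<noteq> 0)"

definition connected_graph :: "'a set \<Rightarrow> 'a set set \<Rightarrow> bool" where
  "connected_graph V E \<longleftrightarrow> (\<forall>u\<in>V. \<forall>v\<in>V. (u, v) \<in> {(x, y). {x, y} \<in> E}\<^sup>*)"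

section \<open>Edge-expansion\<close>

definition vol :: "'a set set \<Rightarrow> 'a set \<Rightarrow> nat" where
  "vol E S = (\<Sum>i\<in>S. vertex_degree E i)"

definition edge_boundary :: "'a set set \<Rightarrow> 'a set \<Rightarrow> 'a set set" where
  "edge_boundary E S = {e \<in> E. \<exists>i j. e = {i, j} \<and> i \<in> S \<and> j \<notin> S}"

definition set_expansion :: "'a set \<Rightarrow> 'a set set \<Rightarrow> 'a set \<Rightarrow> real" where
  "set_expansion V E S = real (card (edge_boundary E S)) / real (min (vol E S) (vol E (V - S)))"

definition edge_expansion :: "'a set \<Rightarrow> 'a set set \<Rightarrow> real" where
  "edge_expansion V E = Min (set_expansion V E ` {S. S \<noteq> {} \<and> S \<subset> V})"

section \<open>The normalized adjacency matrix and its eigenvalues\<close>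

text \<open>Matrices are indexed by \<open>0, \<dots>, n - 1\<close>, so the matrices of a graph depend on an enumeration
  \<open>vs\<close> of its vertices.\<close>

definition adj_matrix :: "'a set set \<Rightarrow> 'a list \<Rightarrow> real mat" where
  "adj_matrix E vs =
     mat (length vs) (length vs) (\<lambda>(i, j). if {vs ! i, vs ! j} \<in> E then 1 else 0)"

definition degree_matrix :: "'a set set \<Rightarrow> 'a list \<Rightarrow> real mat" where
  "degree_matrix E vs = mat_diag (length vs) (\<lambda>i. real (vertex_degree E (vs ! i)))"

definition inv_degree_matrix :: "'a set set \<Rightarrow> 'a list \<Rightarrow> real mat" where
  "inv_degree_matrix E vs = mat_diag (length vs) (\<lambda>i. inverse (real (vertex_degree E (vs ! i))))"

definition normalized_adj_matrix :: "'a set set \<Rightarrow> 'a list \<Rightarrow> real mat" where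
  "normalized_adj_matrix E vs = inv_degree_matrix E vs * adj_matrix E vs"

lemma inv_degree_matrix_inverts:
  assumes "simple_graph V E" and "set vs = V"
  shows "inverts_mat (degree_matrix E vs) (inv_degree_matrix E vs)"
    and "inverts_mat (inv_degree_matrix E vs) (degree_matrix E vs)"
proof -
  have "vertex_degree E (vs ! i) \<noteq> 0" if "i < length vs" for i
    using assms that nth_mem[OF that] unfolding simple_graph_def by blast
  then have "mat_diag (length vs)
      (\<lambda>i. real (vertex_degree E (vs ! i)) * inverse (real (vertex_degree E (vs ! i)))) = 1\<^sub>m (length vs)"
    by (intro eq_matI) (auto simp: mat_diag_def)
  then show "inverts_mat (degree_matrix E vs) (inv_degree_matrix E vs)"
    and "inverts_mat (inv_degree_matrix E vs) (degree_matrix E vs)"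
    unfolding inverts_mat_def degree_matrix_def inv_degree_matrix_def
    by (simp_all add: mult.commute) (simp_all add: mat_diag_def)
qed

text \<open>The real eigenvalues of a matrix, repeated according to their multiplicity as roots of the
  characteristic polynomial, in decreasing order.\<close>

definition eigenvalue_list :: "real mat \<Rightarrow> real list" where
  "eigenvalue_list M = rev (sorted_list_of_multiset (proots (char_poly M)))"

lemma eigenvalue_list_eqI:
  assumes "char_poly M = (\<Prod>a\<leftarrow>as. [:- a, 1:])" and "sorted (rev as)"
  shows "eigenvalue_list M = as"
proof -
  have "proots (\<Prod>a\<leftarrow>as. [:- a, 1:]) = mset as" for as :: "real list"
  proof (induction as)
    case (Cons a as)
    have "(\<Prod>a\<leftarrow>as. [:- a, 1:]) \<noteq> 0" by (auto simp: prod_list_zero_iff)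
    moreover have "proots [:- a, 1:] = {#a#}" by simp
    ultimately show ?case using Cons by (simp add: proots_mult del: mult_pCons_left)
  qed simp
  then have "eigenvalue_list M = rev (sorted_list_of_multiset (mset (rev as)))"
    using assms(1) by (simp add: eigenvalue_list_def)
  also have "\<dots> = as"
    using assms(2) by (simp only: sorted_list_of_multiset_mset sorted_sort_id rev_rev_ident)
  finally show ?thesis .
qed

text \<open>The \<open>k\<close>-th largest eigenvalue, counted from \<open>k = 1\<close>.\<close>

definition eigval :: "real mat \<Rightarrow> nat \<Rightarrow> real" where
  "eigval M k = eigenvalue_list M ! (k - 1)"

end

(*
  Put \<lambda> = 1 - \<mu>_2 and \<epsilon> = 1 + \<mu>_(n-1). With t = sqrt (1 + h^2/\<lambda>) - 1 the claimed bound reads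
  \<epsilon> >= \<lambda> t / (2 (t + 2)), and Cheeger's inequality h^2 <= 2 \<lambda> gives t <= sqrt 3 - 1, so the bound is at
  most 0.134 \<lambda>. It is therefore enough that \<epsilon> >= (2 - sqrt 2)/4 \<lambda> > 0.146 \<lambda>.

  Let f, g be orthonormal eigenfunctions for \<mu>_(n-1) and \<mu>_n. Every unit vector \<phi> in their span satisfies
  sum_{uv in E} (|\<phi> u| - |\<phi> v|)^2 <= sum_{uv in E} (\<phi> u + \<phi> v)^2 <= \<epsilon>, so by the Poincare inequality |\<phi>|
  has variance at most \<epsilon>/\<lambda>, i.e. it is nearly constant when \<epsilon> is small. But |f|, |g|, |f + g|/sqrt 2 and
  |f - g|/sqrt 2 cannot all be nearly constant: their sum is pointwise at most
  sqrt ((4 + 2 sqrt 2) (f^2 + g^2)), which bounds the sum of their means.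
*)
theory Submission
  imports Defs "Jordan_Normal_Form.Schur_Decomposition"
begin

section \<open>Orthogonal diagonalization of real symmetric matrices\<close>

section \<open>The spectral theorem for real symmetric matrices\<close>

text \<open>Gram-Schmidt applied to a basis beginning with \<open>v\<close> leaves \<open>v\<close>
  in first place, and normalizing the columns does not change it because it is already a unit
  vector. This supplies the change of basis for deflation.\<close>

lemma orthonormal_completion:
  fixes v :: "real vec"
  assumes v: "v \<in> carrier_vec n" and norm: "v \<bullet> v = 1"
  obtains W where "W \<in> carrier_mat n n" "W\<^sup>T * W = 1\<^sub>m n" "col W 0 = v"
proof -
  interpret cof_vec_space n "TYPE(real)" .
  have v0: "v \<noteq> 0\<^sub>v n" using norm v by auto
  define b where "b = basis_completion v"
  note bc = basis_completion[OF v v0, folded b_def]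
  obtain vs where bv: "b = v # vs"
    using bc(6,7) v0 v by (cases b) (auto intro!: eq_vecI)
  define ws where "ws = gram_schmidt n b"
  note gs = gram_schmidt_result[OF bc(2,4,5) ws_def]
  have len: "length ws = n" using gs(4) bc(6) by simp
  have hd: "hd ws = v" unfolding ws_def bv using v by simp
  have n: "0 < n" using bc(6) bv by auto
  have ws0: "ws ! 0 = v" using hd len n by (cases ws) auto
  have wsc: "ws ! i \<in> carrier_vec n" if "i < n" for i using gs(3) len that by auto
  have orth: "ws ! i \<bullet> ws ! j = 0 \<longleftrightarrow> i \<noteq> j" if "i < n" "j < n" for i j
    using gs(2) that len unfolding corthogonal_def by simp
  define us where "us = map (\<lambda>w. (1 / sqrt (w \<bullet> w)) \<cdot>\<^sub>v w) ws"
  have us: "us ! i = (1 / sqrt (ws ! i \<bullet> ws ! i)) \<cdot>\<^sub>v ws ! i" if "i < n" for i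
    using that len by (simp add: us_def)
  have usc: "us ! i \<in> carrier_vec n" if "i < n" for i using wsc us that by simp
  define W where "W = mat_of_cols n us"
  have lenu: "length us = n" by (simp add: us_def len)
  have col: "col W i = us ! i" if "i < n" for i
    unfolding W_def using that lenu usc by (intro col_mat_of_cols) auto
  have W: "W \<in> carrier_mat n n" using lenu by (auto simp: W_def)
  have "W\<^sup>T * W = 1\<^sub>m n"
  proof (rule eq_matI)
    fix i j assume "i < dim_row (1\<^sub>m n :: real mat)" "j < dim_col (1\<^sub>m n :: real mat)"
    then have ij: "i < n" "j < n" by auto
    have "(W\<^sup>T * W) $$ (i, j) = us ! i \<bullet> us ! j" using ij W col by simp
    also have "\<dots> = (ws ! i \<bullet> ws ! j) / (sqrt (ws ! i \<bullet> ws ! i) * sqrt (ws ! j \<bullet> ws ! j))"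
      using us ij wsc[OF ij(1)] wsc[OF ij(2)] by simp
    also have "\<dots> = (if i = j then 1 else 0)"
      using orth ij conjugate_square_ge_0_vec[of "ws ! i"] by (auto simp: real_sqrt_mult_self)
    finally show "(W\<^sup>T * W) $$ (i, j) = 1\<^sub>m n $$ (i, j)" using ij by simp
  qed (use W in auto)
  moreover have "col W 0 = v" using col[OF n] us[OF n] ws0 norm by simp
  ultimately show ?thesis using that W by blast
qed

text \<open>Over the complex numbers the characteristic polynomial splits, and its roots are real
  because the matrix is Hermitian. Embedding real polynomials into complex ones is injective, so the
  factorization descends.\<close>

lemma symmetric_real_char_poly_splits:
  fixes A :: "real mat"
  assumes A: "A \<in> carrier_mat n n" and sym: "A\<^sup>T = A"
  obtains es where "char_poly A = (\<Prod>e\<leftarrow>es. [:- e, 1:])" "length es = n"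
proof -
  define C where "C = map_mat complex_of_real A"
  have C: "C \<in> carrier_mat n n" using A by (simp add: C_def)
  have cC: "char_poly C = map_poly complex_of_real (char_poly A)"
    unfolding C_def by (rule of_real_hom.char_poly_hom[OF A])
  obtain as where as: "char_poly C = (\<Prod>a\<leftarrow>as. [:- a, 1:])" "length as = n"
    using char_poly_factorized[OF C] by blast
  interpret map_poly_inj_comm_ring_hom complex_of_real ..
  have "A $$ (j, i) = A $$ (i, j)" if "i < n" "j < n" for i j
    using arg_cong[OF sym, of "\<lambda>M. M $$ (i, j)"] A that by simp
  then have CT: "C\<^sup>T = C"
    using A by (auto simp: C_def intro!: eq_matI)
  have real: "a \<in> \<real>" if "a \<in> set as" for a
  proof -
    have "poly (char_poly C) a = 0"
      using that by (simp add: as(1) poly_prod_list prod_list_zero_iff)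
    then obtain v where "eigenvector C v a"
      using eigenvalue_root_char_poly[OF C] unfolding eigenvalue_def by blast
    then have v: "v \<in> carrier_vec n" "v \<noteq> 0\<^sub>v n" "C *\<^sub>v v = a \<cdot>\<^sub>v v"
      using C by (auto simp: eigenvector_def)
    have cv: "conjugate v \<in> carrier_vec n" using v by simp
    \<comment> \<open>\<open>C\<close> moves across the product by symmetry and commutes with
      conjugation because its entries are real. This compares \<open>a\<close> with its
      conjugate.\<close>
    have "a * (v \<bullet>c v) = (C *\<^sub>v v) \<bullet> conjugate v" using v by simp
    also have "\<dots> = (C\<^sup>T *\<^sub>v v) \<bullet> conjugate v" by (simp only: CT)
    also have "\<dots> = v \<bullet> (C *\<^sub>v conjugate v)"
      by (rule transpose_vec_mult_scalar[OF C cv v(1)])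
    also have "C *\<^sub>v conjugate v = conjugate (C *\<^sub>v v)"
      using A v(1) by (intro eq_vecI) (auto simp: C_def scalar_prod_def)
    also have "v \<bullet> conjugate (C *\<^sub>v v) = cnj a * (v \<bullet>c v)"
      using v by (simp add: conjugate_smult_vec)
    finally have "a = cnj a" using v by simp
    then show ?thesis using Reals_cnj_iff by metis
  qed
  define es where "es = map Re as"
  have "map_poly complex_of_real (\<Prod>e\<leftarrow>es. [:- e, 1:]) = (\<Prod>e\<leftarrow>es. [:- complex_of_real e, 1:])"
    by (simp add: hom_prod_list o_def)
  also have "\<dots> = char_poly C" using real unfolding as es_def
    by (auto intro!: arg_cong[of _ _ prod_list] simp: o_def)
  finally have "char_poly A = (\<Prod>e\<leftarrow>es. [:- e, 1:])" unfolding cC by simp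
  then show ?thesis using that[of es] as(2) by (simp add: es_def)
qed

text \<open>Deflation, by induction on the list of roots: an orthogonal matrix whose first column is
  a unit eigenvector for \<open>e\<close> conjugates \<open>A\<close> into blocks \<open>e\<close>
  and \<open>C\<close>, and \<open>C\<close> is symmetric with the remaining roots. The columns of
  \<open>P\<close> follow the given order of \<open>es\<close>, so a sorted list can be prescribed
  later.\<close>

theorem symmetric_real_spectral:
  fixes A :: "real mat"
  assumes "A \<in> carrier_mat n n" and "A\<^sup>T = A"
    and "char_poly A = (\<Prod>e\<leftarrow>es. [:- e, 1:])"
  shows "\<exists>P \<in> carrier_mat n n. P\<^sup>T * P = 1\<^sub>m n \<and> A * P = P * mat_diag n ((!) es)"
  using assms
proof (induction es arbitrary: n A)
  case Nil
  then have "n = 0" using degree_monic_char_poly[of A n] by simp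
  then show ?case using Nil by (intro bexI[of _ "1\<^sub>m n"]) (auto simp: mat_diag_def intro!: eq_matI)
next
  case (Cons e es)
  note A = Cons.prems(1)
  have mon: "monic (\<Prod>e\<leftarrow>es. [:- e, 1:])" by (rule monic_prod_list) auto
  have "degree (char_poly A) = Suc (degree (\<Prod>e\<leftarrow>es. [:- e, 1:]))"
    unfolding Cons.prems(3) list.map prod_list.Cons by (subst degree_mult_eq) (use mon in auto)
  then have n: "n \<noteq> 0" using degree_monic_char_poly[OF A] by auto
  then obtain m where m: "n = Suc m" by (cases n) auto
  have "eigenvalue A e"
    unfolding eigenvalue_root_char_poly[OF A] Cons.prems(3) by simp
  then obtain u where "eigenvector A u e" unfolding eigenvalue_def by blast
  then have u: "u \<in> carrier_vec n" "u \<noteq> 0\<^sub>v n" "A *\<^sub>v u = e \<cdot>\<^sub>v u"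
    using A by (auto simp: eigenvector_def)
  define v where "v = (1 / sqrt (u \<bullet> u)) \<cdot>\<^sub>v u"
  have "u \<bullet> u > 0" using conjugate_square_greater_0_vec[of u n] u by simp
  then have v: "v \<in> carrier_vec n" "v \<bullet> v = 1" "A *\<^sub>v v = e \<cdot>\<^sub>v v"
    using u A by (auto simp: v_def mult_mat_vec smult_smult_assoc mult.commute)
  obtain W where W: "W \<in> carrier_mat n n" "W\<^sup>T * W = 1\<^sub>m n" "col W 0 = v"
    using orthonormal_completion[OF v(1,2)] .
  have WT: "W\<^sup>T \<in> carrier_mat n n" using W by simp
  have WW: "W * W\<^sup>T = 1\<^sub>m n" by (rule mat_mult_left_right_inverse[OF WT W(1,2)])
  define B where "B = W\<^sup>T * A * W"
  have B: "B \<in> carrier_mat n n" using W A by (simp add: B_def)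
  have Bsym: "B\<^sup>T = B"
    using W(1) WT A Cons.prems(2) unfolding B_def
    by (simp add: transpose_mult[of _ n n _ n] assoc_mult_mat[of _ n n _ n _ n])
  have sim: "similar_mat_wit B A (W\<^sup>T) W"
    by (rule similar_mat_witI[of _ _ n]) (use W WT WW A B in \<open>auto simp: B_def\<close>)
  \<comment> \<open>The first column of \<open>W\<close> is an eigenvector and is orthogonal to the
    others. Symmetry of \<open>B\<close> then clears the first row too.\<close>
  have Bi0: "B $$ (i, 0) = (if i = 0 then e else 0)" if i: "i < n" for i
  proof -
    have "B = W\<^sup>T * (A * W)" using WT A W unfolding B_def by simp
    then have "B $$ (i, 0) = col W i \<bullet> col (A * W) 0" using i n W(1) A by simp
    also have "col (A * W) 0 = A *\<^sub>v col W 0" using n by (intro col_mult2[OF A W(1)]) simp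
    also have "col W i \<bullet> (A *\<^sub>v col W 0) = e * (col W i \<bullet> col W 0)" using v W i by simp
    also have "col W i \<bullet> col W 0 = (W\<^sup>T * W) $$ (i, 0)" using W(1) i n by simp
    finally show ?thesis using W(2) i n by simp
  qed
  have B0i: "B $$ (0, i) = (if i = 0 then e else 0)" if "i < n" for i
    using arg_cong[OF Bsym, of "\<lambda>M. M $$ (0, i)"] B Bi0 n that by auto
  define C where "C = mat m m (\<lambda>(i, j). B $$ (Suc i, Suc j))"
  define E where "E = mat 1 1 (\<lambda>_. e)"
  have C: "C \<in> carrier_mat m m" and E: "E \<in> carrier_mat 1 1" by (auto simp: C_def E_def)
  have Bblock: "B = four_block_mat E (0\<^sub>m 1 m) (0\<^sub>m m 1) C"
    by (rule eq_matI) (use B m in \<open>auto simp: C_def E_def Bi0 B0i\<close>)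
  have "C $$ (j, i) = C $$ (i, j)" if "i < m" "j < m" for i j
    using arg_cong[OF Bsym, of "\<lambda>M. M $$ (Suc i, Suc j)"] B m that by (simp add: C_def)
  then have Csym: "C\<^sup>T = C" using C by (auto intro!: eq_matI)
  have "char_poly A = char_poly B"
    using sim by (intro char_poly_similar[symmetric]) (auto simp: similar_mat_def)
  also have "\<dots> = char_poly E * char_poly C"
    unfolding Bblock by (rule char_poly_four_block_zeros_col[OF E _ C]) simp
  also have "char_poly E = [:- e, 1:]"
    by (simp add: E_def char_poly_defs det_def sign_def)
  finally have "char_poly C = (\<Prod>e\<leftarrow>es. [:- e, 1:])"
    unfolding Cons.prems(3) list.map prod_list.Cons
    by (metis mult_cancel_left pCons_eq_0_iff zero_neq_one)
  from Cons.IH[OF C Csym this] obtain P where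
    P: "P \<in> carrier_mat m m" "P\<^sup>T * P = 1\<^sub>m m" "C * P = P * mat_diag m ((!) es)" by blast
  define F where "F = four_block_mat (1\<^sub>m 1) (0\<^sub>m 1 m) (0\<^sub>m m 1) P"
  have F: "F \<in> carrier_mat n n" using P m unfolding F_def by auto
  have "F\<^sup>T * F = 1\<^sub>m n"
    unfolding F_def using P m
    by (subst transpose_four_block_mat[of _ 1 1 _ m _ m], auto,
        subst mult_four_block_mat[of _ 1 1 _ m _ m _ _ 1 _ m]) auto
  have D: "mat_diag n ((!) (e # es)) = four_block_mat E (0\<^sub>m 1 m) (0\<^sub>m m 1) (mat_diag m ((!) es))"
    by (rule eq_matI) (use m in \<open>auto simp: mat_diag_def E_def nth_Cons'\<close>)
  define D where "D = mat_diag m ((!) es)"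
  have D': "D \<in> carrier_mat m m" by (simp add: D_def)
  have "B * F = four_block_mat E (0\<^sub>m 1 m) (0\<^sub>m m 1) (C * P)"
    unfolding Bblock F_def
    by (subst mult_four_block_mat[of _ 1 1 _ m _ m _ _ 1 _ m]) (use P(1) C E in simp_all)
  moreover have "F * mat_diag n ((!) (e # es)) = four_block_mat E (0\<^sub>m 1 m) (0\<^sub>m m 1) (P * D)"
    unfolding D F_def D_def[symmetric]
    by (subst mult_four_block_mat[of _ 1 1 _ m _ m _ _ 1 _ m]) (use P(1) D' E in simp_all)
  ultimately have BF: "B * F = F * mat_diag n ((!) (e # es))"
    using P(3) by (simp add: D_def)
  have "(W * F)\<^sup>T * (W * F) = F\<^sup>T * (W\<^sup>T * W) * F"
    using W(1) WT F by (simp add: transpose_mult[of _ n n _ n] assoc_mult_mat[of _ n n _ n _ n])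
  also have "\<dots> = 1\<^sub>m n" using W(2) F \<open>F\<^sup>T * F = 1\<^sub>m n\<close> by simp
  finally have "(W * F)\<^sup>T * (W * F) = 1\<^sub>m n" .
  moreover have "A * (W * F) = W * F * mat_diag n ((!) (e # es))"
  proof -
    have "A * (W * F) = (W * W\<^sup>T) * (A * (W * F))" unfolding WW using A W F by simp
    also have "\<dots> = W * (B * F)" unfolding B_def
      using W(1) WT F A by (simp add: assoc_mult_mat[of _ n n _ n _ n])
    also have "\<dots> = W * F * mat_diag n ((!) (e # es))"
      unfolding BF using W(1) F by (simp add: assoc_mult_mat[of _ n n _ n _ n])
    finally show ?thesis .
  qed
  ultimately show ?case using W F by (intro bexI[of _ "W * F"]) auto
qed

section \<open>Eigenbasis of a degree-normalized symmetric matrix\<close>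

text \<open>With D the diagonal matrix of \<open>d\<close>, the matrix D^(-1) w is similar to the
  symmetric matrix D^(-1/2) w D^(-1/2), to which the spectral theorem applies. Orthonormality of the
  columns of \<open>P\<close> becomes orthonormality with weights \<open>d\<close>; the last
  conclusion is \<open>P * P\<^sup>T = 1\<^sub>m n\<close> and later provides completeness.\<close>

lemma weighted_eigenbasis:
  fixes w :: "nat \<Rightarrow> nat \<Rightarrow> real" and d :: "nat \<Rightarrow> real"
  assumes sym: "\<And>i j. w i j = w j i" and d: "\<And>i. i < n \<Longrightarrow> d i > 0"
  defines "\<mu> \<equiv> eigenvalue_list (mat n n (\<lambda>(i, j). inverse (d i) * w i j))"
  obtains e where "length \<mu> = n" "sorted (rev \<mu>)"
    "\<And>k l. \<lbrakk>k < n; l < n\<rbrakk> \<Longrightarrow> (\<Sum>i<n. d i * e k i * e l i) = (if k = l then 1 else 0)"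
    "\<And>k i. \<lbrakk>k < n; i < n\<rbrakk> \<Longrightarrow> (\<Sum>j<n. w i j * e k j) = \<mu> ! k * d i * e k i"
    "\<And>i j. \<lbrakk>i < n; j < n\<rbrakk> \<Longrightarrow> d j * (\<Sum>k<n. e k i * e k j) = (if i = j then 1 else 0)"
proof -
  define M where "M = mat n n (\<lambda>(i, j). inverse (d i) * w i j)"
  define A where "A = mat n n (\<lambda>(i, j). w i j / (sqrt (d i) * sqrt (d j)))"
  define R where "R = mat_diag n (\<lambda>i. sqrt (d i))"
  define R' where "R' = mat_diag n (\<lambda>i. 1 / sqrt (d i))"
  have A: "A \<in> carrier_mat n n" "A\<^sup>T = A"
    by (auto simp: A_def sym mult.commute intro!: eq_matI)
  have d0: "sqrt (d i) \<noteq> 0" "d i = sqrt (d i) * sqrt (d i)" if "i < n" for i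
    using d[OF that] by simp_all
  have "sqrt (d i) * (1 / sqrt (d i)) = 1" "1 / sqrt (d i) * sqrt (d i) = 1" if "i < n" for i
    using d0(1)[OF that] by simp_all
  then have RR: "R * R' = 1\<^sub>m n" "R' * R = 1\<^sub>m n"
    unfolding R_def R'_def mat_diag_diag by (auto simp: mat_diag_def intro!: eq_matI)
  have R'A: "R' * A = mat n n (\<lambda>(i, j). 1 / sqrt (d i) * A $$ (i, j))"
    unfolding R'_def by (rule mat_diag_mult_left[OF A(1)])
  have "R' * A * R = mat n n (\<lambda>(i, j). (R' * A) $$ (i, j) * sqrt (d j))"
    unfolding R_def by (rule mat_diag_mult_right) (simp add: R'A)
  also have "\<dots> = M"
  proof (rule eq_matI)
    fix i j assume "i < dim_row M" "j < dim_col M"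
    then have ij: "i < n" "j < n" by (auto simp: M_def)
    have "inverse (d i) * w i j = 1 / sqrt (d i) * (w i j / (sqrt (d i) * sqrt (d j))) * sqrt (d j)"
      using d0(1)[OF ij(1)] d0(1)[OF ij(2)] by (subst d0(2)[OF ij(1)]) (simp add: divide_simps)
    also have "1 / sqrt (d i) * (w i j / (sqrt (d i) * sqrt (d j))) = (R' * A) $$ (i, j)"
      unfolding R'A using ij by (simp add: A_def)
    finally show "mat n n (\<lambda>(i, j). (R' * A) $$ (i, j) * sqrt (d j)) $$ (i, j) = M $$ (i, j)"
      using ij unfolding M_def by simp
  qed (auto simp: M_def)
  finally have "M = R' * A * R" by simp
  moreover have "R \<in> carrier_mat n n" "R' \<in> carrier_mat n n" "M \<in> carrier_mat n n"
    by (simp_all add: R_def R'_def M_def)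
  ultimately have "similar_mat_wit M A R' R"
    using A(1) RR by (intro similar_mat_witI[of _ _ n])
  then have cp: "char_poly M = char_poly A"
    by (intro char_poly_similar) (auto simp: similar_mat_def)
  obtain es where es: "char_poly A = (\<Prod>e\<leftarrow>es. [:- e, 1:])" "length es = n"
    using symmetric_real_char_poly_splits[OF A] .
  \<comment> \<open>The roots come in no particular order; permuting the factors makes them
    decreasing, as in \<open>eigenvalue_list\<close>.\<close>
  have "prod_list (map (\<lambda>e. [:- e, 1:]) es) = prod_list (map (\<lambda>e. [:- e, 1:]) (rev (sort es)))"
    by (simp flip: prod_mset_prod_list)
  then have cpA: "char_poly A = (\<Prod>e\<leftarrow>rev (sort es). [:- e, 1:])" using es by simp
  then have \<mu>: "\<mu> = rev (sort es)"
    unfolding \<mu>_def M_def[symmetric] by (intro eigenvalue_list_eqI) (simp_all add: cp)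
  obtain P where P: "P \<in> carrier_mat n n" "P\<^sup>T * P = 1\<^sub>m n" "A * P = P * mat_diag n ((!) \<mu>)"
    using symmetric_real_spectral[OF A cpA] unfolding \<mu> by blast
  have PT: "P\<^sup>T \<in> carrier_mat n n" using P by simp
  have PP: "P * P\<^sup>T = 1\<^sub>m n" by (rule mat_mult_left_right_inverse[OF PT P(1,2)])
  have dn: "d i \<noteq> 0" "\<bar>d i\<bar> = d i" if "i < n" for i using d[OF that] by simp_all
  \<comment> \<open>Dividing by the square root of \<open>d i\<close> carries eigenvectors of
    \<open>A\<close> back to eigenvectors of \<open>M\<close>.\<close>
  define e where "e k i = P $$ (i, k) / sqrt (d i)" for k i
  have "(\<Sum>i<n. d i * e k i * e l i) = (if k = l then 1 else 0)" if "k < n" "l < n" for k l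
  proof -
    have "(\<Sum>i<n. d i * e k i * e l i) = (\<Sum>i<n. P $$ (i, k) * P $$ (i, l))"
      by (intro sum.cong refl) (auto simp: e_def field_simps dn)
    also have "\<dots> = (P\<^sup>T * P) $$ (k, l)"
      using that P(1) by (simp add: scalar_prod_def atLeast0LessThan)
    finally show ?thesis using P(2) that by simp
  qed
  moreover have "(\<Sum>j<n. w i j * e k j) = \<mu> ! k * d i * e k i" if "k < n" "i < n" for k i
  proof -
    have "(\<Sum>j<n. w i j * e k j) = sqrt (d i) * (\<Sum>j<n. A $$ (i, j) * P $$ (j, k))"
      unfolding sum_distrib_left
      using that by (intro sum.cong refl) (auto simp: e_def A_def field_simps dn)
    also have "(\<Sum>j<n. A $$ (i, j) * P $$ (j, k)) = (A * P) $$ (i, k)"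
      using that P(1) A(1) by (simp add: scalar_prod_def atLeast0LessThan)
    also have "\<dots> = P $$ (i, k) * \<mu> ! k"
      unfolding P(3) using that P(1) by (simp add: mat_diag_mult_right[OF P(1)])
    also have "sqrt (d i) * (P $$ (i, k) * \<mu> ! k) = \<mu> ! k * d i * e k i"
      using that by (simp add: e_def field_simps dn)
    finally show ?thesis .
  qed
  moreover have "d j * (\<Sum>k<n. e k i * e k j) = (if i = j then 1 else 0)" if "i < n" "j < n" for i j
  proof -
    have "d j * (\<Sum>k<n. e k i * e k j) = sqrt (d j) / sqrt (d i) * (\<Sum>k<n. P $$ (i, k) * P $$ (j, k))"
      unfolding sum_distrib_left
      using d that by (intro sum.cong refl) (auto simp: e_def field_simps abs_of_pos dest!: d)
    also have "(\<Sum>k<n. P $$ (i, k) * P $$ (j, k)) = (P * P\<^sup>T) $$ (i, j)"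
      using that P(1) by (simp add: scalar_prod_def atLeast0LessThan)
    finally show ?thesis using PP that d[of i] by auto
  qed
  moreover have "length \<mu> = n" "sorted (rev \<mu>)" using \<mu> es by auto
  ultimately show ?thesis using that by blast
qed

section \<open>Quadratic forms of a weighted graph\<close>

section \<open>Weighted graphs\<close>

locale weighted_graph =
  fixes V :: "'a set" and w :: "'a \<Rightarrow> 'a \<Rightarrow> real" and d :: "'a \<Rightarrow> real"
  assumes finite_V: "finite V" and w_sym: "w u v = w v u" and w_nonneg: "w u v \<ge> 0"
    and degree: "u \<in> V \<Longrightarrow> d u = (\<Sum>v\<in>V. w u v)" and degree_pos: "u \<in> V \<Longrightarrow> d u > 0"
begin

text \<open>The degree weights make D^(-1) w self-adjoint, and \<open>adj_form f g\<close> is then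
  the inner product of \<open>f\<close> with D^(-1) w applied to \<open>g\<close>.\<close>

definition inner :: "('a \<Rightarrow> real) \<Rightarrow> ('a \<Rightarrow> real) \<Rightarrow> real" where
  "inner f g = (\<Sum>u\<in>V. d u * f u * g u)"

definition adj_form :: "('a \<Rightarrow> real) \<Rightarrow> ('a \<Rightarrow> real) \<Rightarrow> real" where
  "adj_form f g = (\<Sum>u\<in>V. \<Sum>v\<in>V. w u v * f u * g v)"

text \<open>Every edge is counted in both directions, so \<open>energy\<close> is twice the Dirichlet form.\<close>

definition energy :: "('a \<Rightarrow> real) \<Rightarrow> real" where
  "energy f = (\<Sum>u\<in>V. \<Sum>v\<in>V. w u v * (f u - f v)\<^sup>2)"

definition signless_energy :: "('a \<Rightarrow> real) \<Rightarrow> real" where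
  "signless_energy f = (\<Sum>u\<in>V. \<Sum>v\<in>V. w u v * (f u + f v)\<^sup>2)"

definition volume :: "'a set \<Rightarrow> real" where
  "volume S = (\<Sum>u\<in>S. d u)"

definition boundary_weight :: "'a set \<Rightarrow> real" where
  "boundary_weight S = (\<Sum>u\<in>S. \<Sum>v\<in>V - S. w u v)"

lemma double_sum_mono:
  assumes "\<And>u v. \<lbrakk>u \<in> V; v \<in> V\<rbrakk> \<Longrightarrow> a u v \<le> b u v"
  shows "(\<Sum>u\<in>V. \<Sum>v\<in>V. w u v * a u v) \<le> (\<Sum>u\<in>V. \<Sum>v\<in>V. w u v * b u v)"
  using assms w_nonneg by (intro sum_mono mult_left_mono)

lemma double_sum_degree:
  "(\<Sum>u\<in>V. \<Sum>v\<in>V. w u v * F u) = (\<Sum>u\<in>V. d u * F u)"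
  "(\<Sum>u\<in>V. \<Sum>v\<in>V. w u v * F v) = (\<Sum>u\<in>V. d u * F u)"
proof -
  show *: "(\<Sum>u\<in>V. \<Sum>v\<in>V. w u v * F u) = (\<Sum>u\<in>V. d u * F u)"
    by (simp add: degree sum_distrib_right)
  show "(\<Sum>u\<in>V. \<Sum>v\<in>V. w u v * F v) = (\<Sum>u\<in>V. d u * F u)"
    by (subst sum.swap, subst w_sym) (rule *)
qed

lemma inner_commute: "inner f g = inner g f"
  by (simp add: inner_def mult_ac)

lemma inner_add_left: "inner (\<lambda>u. a * f u + b * g u) k = a * inner f k + b * inner g k"
  by (simp add: inner_def sum.distrib sum_distrib_left algebra_simps)

lemma inner_add_right: "inner k (\<lambda>u. a * f u + b * g u) = a * inner k f + b * inner k g"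
  by (simp add: inner_commute[of k] inner_add_left)

lemma adj_form_commute: "adj_form f g = adj_form g f"
  unfolding adj_form_def by (subst sum.swap, subst w_sym) (simp add: mult_ac)

lemma adj_form_add_left:
  "adj_form (\<lambda>u. a * f u + b * g u) k = a * adj_form f k + b * adj_form g k"
  by (simp add: adj_form_def sum.distrib sum_distrib_left algebra_simps)

lemma adj_form_add_right:
  "adj_form k (\<lambda>u. a * f u + b * g u) = a * adj_form k f + b * adj_form k g"
  by (simp add: adj_form_commute[of k] adj_form_add_left)

lemma inner_self_nonneg: "inner f f \<ge> 0"
  unfolding inner_def using degree_pos
  by (intro sum_nonneg) (auto simp: mult.assoc less_imp_le)

lemma energy_nonneg: "energy f \<ge> 0" and signless_energy_nonneg: "signless_energy f \<ge> 0"
  unfolding energy_def signless_energy_def using w_nonneg by (auto intro!: sum_nonneg)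

lemma energy_eq: "energy f = 2 * (inner f f - adj_form f f)"
proof -
  have "energy f = (\<Sum>u\<in>V. \<Sum>v\<in>V. w u v * (f u)\<^sup>2 + w u v * (f v)\<^sup>2 - 2 * (w u v * f u * f v))"
    unfolding energy_def by (intro sum.cong refl) (simp add: power2_eq_square algebra_simps)
  also have "\<dots> = 2 * (inner f f - adj_form f f)"
    by (simp add: sum.distrib sum_subtractf double_sum_degree sum_distrib_left[symmetric]
        inner_def adj_form_def) (simp add: power2_eq_square mult.assoc)
  finally show ?thesis .
qed

lemma signless_energy_eq: "signless_energy f = 2 * (inner f f + adj_form f f)"
proof -
  have "signless_energy f = (\<Sum>u\<in>V. \<Sum>v\<in>V. w u v * (f u)\<^sup>2 + w u v * (f v)\<^sup>2 + 2 * (w u v * f u * f v))"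
    unfolding signless_energy_def by (intro sum.cong refl) (simp add: power2_eq_square algebra_simps)
  also have "\<dots> = 2 * (inner f f + adj_form f f)"
    by (simp add: sum.distrib double_sum_degree sum_distrib_left[symmetric]
        inner_def adj_form_def) (simp add: power2_eq_square mult.assoc)
  finally show ?thesis .
qed

text \<open>Reverse triangle inequality for \<open>f u\<close> and \<open>- f v\<close>: passing to
  absolute values turns near antisymmetry along edges into near constancy.\<close>

lemma energy_abs_le: "energy (\<lambda>u. \<bar>f u\<bar>) \<le> signless_energy f"
  unfolding energy_def signless_energy_def
proof (rule double_sum_mono)
  show "(\<bar>f u\<bar> - \<bar>f v\<bar>)\<^sup>2 \<le> (f u + f v)\<^sup>2" for u v
    by (rule abs_le_square_iff[THEN iffD1]) (simp add: abs_if)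
qed

section \<open>Cheeger's inequality via level sets\<close>

subsection \<open>Cheeger's inequality\<close>

lemma boundary_weight_indicator:
  assumes "S \<subseteq> V"
  shows "(\<Sum>u\<in>V. \<Sum>v\<in>V. w u v * of_bool ((u \<in> S) \<noteq> (v \<in> S))) = 2 * boundary_weight S"
proof -
  have V: "V = S \<union> (V - S)" using assms by blast
  have fin: "finite S" "finite (V - S)" using assms finite_V finite_subset by auto
  have split: "(\<Sum>u\<in>V. g u) = (\<Sum>u\<in>S. g u) + (\<Sum>u\<in>V - S. g u)" for g :: "'a \<Rightarrow> real"
    using fin by (subst V, subst sum.union_disjoint) auto
  have "(\<Sum>u\<in>V. \<Sum>v\<in>V. w u v * of_bool ((u \<in> S) \<noteq> (v \<in> S)))
      = (\<Sum>u\<in>S. \<Sum>v\<in>V - S. w u v) + (\<Sum>u\<in>V - S. \<Sum>v\<in>S. w u v)"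
    unfolding split by (intro arg_cong2[of _ _ _ _ "(+)"] sum.cong refl) (auto intro: sum.neutral)
  also have "(\<Sum>u\<in>V - S. \<Sum>v\<in>S. w u v) = boundary_weight S"
    unfolding boundary_weight_def by (subst sum.swap, subst w_sym) (rule refl)
  finally show ?thesis by (simp add: boundary_weight_def)
qed

text \<open>Coarea inequality, by peeling off the lowest positive level of \<open>F\<close>.\<close>

lemma coarea:
  assumes "\<And>u. u \<in> V \<Longrightarrow> F u \<ge> 0"
    and "\<And>S. S \<subseteq> {u \<in> V. F u > 0} \<Longrightarrow> h * volume S \<le> boundary_weight S"
  shows "2 * h * (\<Sum>u\<in>V. d u * F u) \<le> (\<Sum>u\<in>V. \<Sum>v\<in>V. w u v * \<bar>F u - F v\<bar>)"
  using assms
proof (induction "card {u \<in> V. F u > 0}" arbitrary: F rule: less_induct)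
  case less
  define S where "S = {u \<in> V. F u > 0}"
  have S: "S \<subseteq> V" "finite S" using finite_V by (auto simp: S_def)
  show ?case
  proof (cases "S = {}")
    case True
    then have "F u = 0" if "u \<in> V" for u using less.prems(1)[OF that] that by (force simp: S_def)
    then show ?thesis using w_nonneg by (simp add: sum_nonneg)
  next
    case False
    define m where "m = Min (F ` S)"
    have "m \<in> F ` S" using S False by (simp add: m_def)
    then obtain u0 where u0: "u0 \<in> S" "F u0 = m" by auto
    have m: "m > 0" using u0 by (simp add: S_def)
    have mle: "m \<le> F u" if "u \<in> S" for u using that S by (simp add: m_def)
    have out: "F u = 0" if "u \<in> V" "u \<notin> S" for u
      using less.prems(1)[OF that(1)] that by (force simp: S_def)
    define G where "G u = (if u \<in> S then F u - m else F u)" for u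
    have "u \<in> S - {u0}" if "u \<in> V" "G u > 0" for u
      by (cases "u \<in> S") (use u0 out that in \<open>auto simp: G_def\<close>)
    \<comment> \<open>\<open>G\<close> vanishes at \<open>u0\<close>, where the minimum
      \<open>m\<close> is attained, so the support shrinks strictly and the induction hypothesis
      applies.\<close>
    then have supp: "{u \<in> V. G u > 0} \<subseteq> S - {u0}" by blast
    then have "card {u \<in> V. G u > 0} \<le> card (S - {u0})" using S by (intro card_mono) auto
    also have "\<dots> < card S" using u0 S by (intro card_Diff1_less) auto
    finally have "card {u \<in> V. G u > 0} < card {u \<in> V. F u > 0}" by (simp add: S_def)
    then have "2 * h * (\<Sum>u\<in>V. d u * G u) \<le> (\<Sum>u\<in>V. \<Sum>v\<in>V. w u v * \<bar>G u - G v\<bar>)"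
    proof (rule less.hyps)
      show "G u \<ge> 0" if "u \<in> V" for u using that mle out by (simp add: G_def)
      show "h * volume T \<le> boundary_weight T" if "T \<subseteq> {u \<in> V. G u > 0}" for T
        by (rule less.prems(2)) (use that supp in \<open>auto simp: S_def\<close>)
    qed
    moreover have "(\<Sum>u\<in>V. d u * F u) = (\<Sum>u\<in>V. d u * G u) + m * volume S"
    proof -
      have "(\<Sum>u\<in>V. d u * F u) = (\<Sum>u\<in>V. d u * G u + (if u \<in> S then m * d u else 0))"
        by (intro sum.cong) (auto simp: G_def algebra_simps)
      then show ?thesis
        using S finite_V by (simp add: sum.distrib sum.inter_restrict[symmetric] Int_absorb1
            volume_def sum_distrib_left)
    qed
    moreover have "(\<Sum>u\<in>V. \<Sum>v\<in>V. w u v * \<bar>F u - F v\<bar>)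
        = (\<Sum>u\<in>V. \<Sum>v\<in>V. w u v * \<bar>G u - G v\<bar>) + m * (2 * boundary_weight S)"
    proof -
      \<comment> \<open>Inside \<open>S\<close> the shift by \<open>m\<close> cancels. If just one
        endpoint lies in \<open>S\<close>, the other value is 0 and the difference drops by exactly
        \<open>m\<close>.\<close>
      have "w u v * \<bar>F u - F v\<bar> = w u v * \<bar>G u - G v\<bar> + m * (w u v * of_bool ((u \<in> S) \<noteq> (v \<in> S)))"
        if "u \<in> V" "v \<in> V" for u v
        using out[OF that(1)] out[OF that(2)] mle[of u] mle[of v] m
        by (auto simp: G_def algebra_simps abs_if)
      then have "(\<Sum>u\<in>V. \<Sum>v\<in>V. w u v * \<bar>F u - F v\<bar>)
        = (\<Sum>u\<in>V. \<Sum>v\<in>V. w u v * \<bar>G u - G v\<bar> + m * (w u v * of_bool ((u \<in> S) \<noteq> (v \<in> S))))"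
        by (intro sum.cong refl) auto
      also have "\<dots> = (\<Sum>u\<in>V. \<Sum>v\<in>V. w u v * \<bar>G u - G v\<bar>) + m * (2 * boundary_weight S)"
        by (simp only: sum.distrib sum_distrib_left[symmetric] boundary_weight_indicator[OF S(1)])
      finally show ?thesis .
    qed
    moreover have "m * (h * volume S) \<le> m * boundary_weight S"
      using less.prems(2)[of S] m by (intro mult_left_mono) (auto simp: S_def)
    ultimately show ?thesis by (simp add: algebra_simps)
  qed
qed

text \<open>The coarea inequality is applied to the square of \<open>g\<close>, which has the same
  positive support. A difference of squares factors into a difference and a sum, and these are
  controlled by \<open>energy\<close> and \<open>signless_energy\<close>, which add up to
  \<open>4 * inner g g\<close>. Since \<open>energy\<close> counts each edge twice, this is the
  usual bound h^2/2 on the Rayleigh quotient.\<close>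

lemma cheeger_half:
  assumes h: "h \<ge> 0" and g: "\<And>u. u \<in> V \<Longrightarrow> g u \<ge> 0"
    and cut: "\<And>S. S \<subseteq> {u \<in> V. g u > 0} \<Longrightarrow> h * volume S \<le> boundary_weight S"
  shows "h\<^sup>2 * inner g g \<le> energy g"
proof (cases "h = 0")
  case True
  then show ?thesis using energy_nonneg by simp
next
  case False
  then have h: "h > 0" using h by simp
  have pos: "(g u)\<^sup>2 > 0 \<longleftrightarrow> g u > 0" if "u \<in> V" for u using g[OF that] by auto
  have "2 * h * inner g g = 2 * h * (\<Sum>u\<in>V. d u * (g u)\<^sup>2)"
    by (simp add: inner_def power2_eq_square mult.assoc)
  also have "\<dots> \<le> (\<Sum>u\<in>V. \<Sum>v\<in>V. w u v * \<bar>(g u)\<^sup>2 - (g v)\<^sup>2\<bar>)"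
    by (rule coarea) (use cut pos in \<open>auto cong: conj_cong\<close>)
  \<comment> \<open>Weighted AM-GM in place of Cauchy-Schwarz. The weight \<open>h / 4\<close> makes
    the second term at most \<open>h * inner g g\<close>, which is half of the left side.\<close>
  also have "\<dots> \<le> (\<Sum>u\<in>V. \<Sum>v\<in>V. w u v * ((g u - g v)\<^sup>2 / h + h / 4 * (g u + g v)\<^sup>2))"
  proof (rule double_sum_mono)
    fix u v assume "u \<in> V" "v \<in> V"
    have "\<bar>(g u)\<^sup>2 - (g v)\<^sup>2\<bar> = \<bar>g u - g v\<bar> * \<bar>g u + g v\<bar>"
      by (simp add: abs_mult[symmetric] power2_eq_square algebra_simps)
    also have "\<dots> \<le> \<bar>g u - g v\<bar>\<^sup>2 / h + h / 4 * \<bar>g u + g v\<bar>\<^sup>2"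
    proof -
      have "0 \<le> (2 * \<bar>g u - g v\<bar> - h * \<bar>g u + g v\<bar>)\<^sup>2" by simp
      then show ?thesis using h by (simp add: field_simps power2_eq_square)
    qed
    finally show "\<bar>(g u)\<^sup>2 - (g v)\<^sup>2\<bar> \<le> (g u - g v)\<^sup>2 / h + h / 4 * (g u + g v)\<^sup>2" by simp
  qed
  also have "\<dots> = (\<Sum>u\<in>V. \<Sum>v\<in>V. w u v * (g u - g v)\<^sup>2 / h + h / 4 * (w u v * (g u + g v)\<^sup>2))"
    by (intro sum.cong refl) (simp add: algebra_simps)
  also have "\<dots> = energy g / h + h / 4 * signless_energy g"
    by (simp only: sum.distrib sum_distrib_left[symmetric] sum_divide_distrib[symmetric]
        energy_def signless_energy_def)
  also have "signless_energy g \<le> 4 * inner g g"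
    using energy_nonneg[of g] by (simp add: energy_eq signless_energy_eq)
  finally have "h * inner g g \<le> energy g / h" using h by (simp add: mult_left_mono)
  then show ?thesis using h by (simp add: field_simps power2_eq_square)
qed

lemma volume_mono: "\<lbrakk>S \<subseteq> T; T \<subseteq> V\<rbrakk> \<Longrightarrow> volume S \<le> volume T"
  unfolding volume_def using degree_pos finite_V
  by (intro sum_mono2) (auto intro: finite_subset less_imp_le)

lemma volume_Diff: "S \<subseteq> V \<Longrightarrow> volume (V - S) = volume V - volume S"
  unfolding volume_def using finite_V by (intro sum_diff) auto

text \<open>A median for the measure \<open>d\<close>: the least value of \<open>f\<close> whose
  strict upper level set has at most half the volume. The maximum of \<open>f\<close> shows that
  such values exist.\<close>

lemma median_exists:
  fixes f :: "'a \<Rightarrow> real"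
  assumes "V \<noteq> {}"
  obtains m where "2 * volume {u \<in> V. f u > m} \<le> volume V" "2 * volume {u \<in> V. f u < m} \<le> volume V"
proof -
  define M where "M = {f u | u. u \<in> V \<and> 2 * volume {v \<in> V. f v > f u} \<le> volume V}"
  have fin: "finite M" using finite_V unfolding M_def by simp
  have "Max (f ` V) \<in> f ` V" using finite_V assms by simp
  then obtain t where t: "t \<in> V" "f t = Max (f ` V)" by force
  then have empty: "{v \<in> V. f v > f t} = {}" using finite_V by (auto simp: not_less)
  have "2 * volume {v \<in> V. f v > f t} \<le> volume V"
    unfolding empty using volume_mono[of "{}" V] by (simp add: volume_def)
  then have "f t \<in> M" using t unfolding M_def by blast
  then have ne: "M \<noteq> {}" by blast
  define m where "m = Min M"
  have "m \<in> M" using Min_in fin ne by (simp add: m_def)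
  moreover have "2 * volume {u \<in> V. f u < m} \<le> volume V"
  proof (rule ccontr)
    assume *: "\<not> ?thesis"
    define L where "L = {u \<in> V. f u < m}"
    have L: "L \<subseteq> V" "finite L" using finite_V by (auto simp: L_def)
    have "L \<noteq> {}" using * volume_mono[of "{}" V] by (auto simp: L_def[symmetric] volume_def)
    then have "Max (f ` L) \<in> f ` L" using L by simp
    then obtain s where s: "s \<in> L" "f s = Max (f ` L)" by force
    \<comment> \<open>The largest value below \<open>m\<close> would also qualify, since everything
      above it lies outside \<open>L\<close>, which has more than half the volume. That contradicts
      minimality of \<open>m\<close>.\<close>
    have "f v \<le> f s" if "v \<in> L" for v using that s(2) L by simp
    then have "{v \<in> V. f v > f s} \<subseteq> V - L" by force
    then have "volume {v \<in> V. f v > f s} \<le> volume V - volume L"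
      using volume_mono[of _ "V - L"] volume_Diff[OF L(1)] by force
    then have "f s \<in> M" using * s L unfolding M_def L_def[symmetric] by force
    then have "m \<le> f s" using fin by (simp add: m_def)
    then show False using s by (simp add: L_def)
  qed
  ultimately show ?thesis using that unfolding M_def by blast
qed

text \<open>After subtraction of a median, the positive part \<open>p\<close> and the negative part
  \<open>q\<close> live on sets of at most half the volume, so \<open>cheeger_half\<close> applies
  to each. The shift does not decrease the norm because \<open>f\<close> is orthogonal to constants,
  and splitting does not increase the energy.\<close>

theorem cheeger:
  assumes "V \<noteq> {}" and h: "h \<ge> 0"
    and cut: "\<And>S. \<lbrakk>S \<subseteq> V; 2 * volume S \<le> volume V\<rbrakk> \<Longrightarrow> h * volume S \<le> boundary_weight S"
    and f: "inner f (\<lambda>_. 1) = 0"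
  shows "h\<^sup>2 * inner f f \<le> energy f"
proof -
  obtain m where m: "2 * volume {u \<in> V. f u > m} \<le> volume V" "2 * volume {u \<in> V. f u < m} \<le> volume V"
    using median_exists[OF assms(1)] .
  define p where "p u = max (f u - m) 0" for u
  define q where "q u = max (m - f u) 0" for u
  have small: "h * volume S \<le> boundary_weight S" if "S \<subseteq> T" "T \<subseteq> V" "2 * volume T \<le> volume V" for S T
    using cut[of S] volume_mono[of S T] that by auto
  have "h\<^sup>2 * inner p p \<le> energy p"
    by (rule cheeger_half[OF h]) (use m(1) in \<open>auto simp: p_def intro!: small[of _ "{u \<in> V. f u > m}"]\<close>)
  moreover have "h\<^sup>2 * inner q q \<le> energy q"
    by (rule cheeger_half[OF h]) (use m(2) in \<open>auto simp: q_def intro!: small[of _ "{u \<in> V. f u < m}"]\<close>)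
  moreover have "inner f f \<le> inner p p + inner q q"
  proof -
    have "inner p p + inner q q = (\<Sum>u\<in>V. d u * f u * f u + m\<^sup>2 * d u - 2 * m * (d u * f u * 1))"
      unfolding inner_def sum.distrib[symmetric]
      by (intro sum.cong refl) (auto simp: p_def q_def max_def algebra_simps power2_eq_square)
    also have "\<dots> = inner f f + m\<^sup>2 * volume V - 2 * m * inner f (\<lambda>_. 1)"
      by (simp only: sum.distrib sum_subtractf sum_distrib_left[symmetric] inner_def volume_def)
    finally show ?thesis using f volume_mono[of "{}" V] by (simp add: volume_def)
  qed
  moreover have "energy p + energy q \<le> energy f"
  proof -
    have "energy p + energy q = (\<Sum>u\<in>V. \<Sum>v\<in>V. w u v * ((p u - p v)\<^sup>2 + (q u - q v)\<^sup>2))"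
      by (simp add: energy_def sum.distrib algebra_simps)
    also have "\<dots> \<le> energy f" unfolding energy_def
    proof (rule double_sum_mono)
      fix u v
      \<comment> \<open>\<open>p\<close> increases and \<open>q\<close> decreases with
        \<open>f\<close>, so the cross term in the expanded square is nonnegative.\<close>
      have *: "f u - f v = (p u - p v) - (q u - q v)" and "(p u - p v) * (q u - q v) \<le> 0"
        by (auto simp: p_def q_def max_def mult_nonneg_nonpos mult_nonpos_nonneg)
      then show "(p u - p v)\<^sup>2 + (q u - q v)\<^sup>2 \<le> (f u - f v)\<^sup>2"
        unfolding *
        by (simp add: power2_eq_square algebra_simps)
    qed
    finally show ?thesis .
  qed
  moreover have "h\<^sup>2 * inner f f \<le> h\<^sup>2 * (inner p p + inner q q)"
    using calculation(3) by (intro mult_left_mono) auto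
  ultimately show ?thesis by (simp add: algebra_simps)
qed

section \<open>Lower bound for the signless energy on a two-dimensional space\<close>

subsection \<open>Two nearly antisymmetric functions\<close>

lemma inner_one: "inner (\<lambda>_. 1) (\<lambda>_. 1) = volume V"
  by (simp add: inner_def volume_def)

lemma volume_pos: "V \<noteq> {} \<Longrightarrow> volume V > 0"
  unfolding volume_def using degree_pos finite_V by (intro sum_pos) auto

text \<open>The Poincare inequality bounds the variance of the absolute value of \<open>f\<close> by
  its energy, hence by the signless energy of \<open>f\<close>. As the second moment is 1, a small
  variance forces a large mean.\<close>

lemma inner_abs_one_ge:
  assumes "V \<noteq> {}" and "l > 0"
    and poincare: "\<And>f. inner f (\<lambda>_. 1) = 0 \<Longrightarrow> 2 * l * inner f f \<le> energy f"
    and "inner f f = 1" and "signless_energy f \<le> 2 * \<epsilon>"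
  shows "volume V * (1 - \<epsilon> / l) \<le> (inner (\<lambda>u. \<bar>f u\<bar>) (\<lambda>_. 1))\<^sup>2"
proof -
  define a where "a = inner (\<lambda>u. \<bar>f u\<bar>) (\<lambda>_. 1)"
  define c where "c = volume V"
  have c: "c > 0" unfolding c_def by (rule volume_pos) fact
  \<comment> \<open>The absolute value of \<open>f\<close> minus its weighted mean
    \<open>a / c\<close>; the factors 1 match the shape of \<open>inner_add_left\<close>.\<close>
  define F where "F = (\<lambda>u. 1 * \<bar>f u\<bar> + (- a / c) * 1)"
  have F1: "inner F (\<lambda>_. 1) = 0"
    unfolding F_def inner_add_left inner_one using c by (simp add: a_def c_def)
  have "inner F F = 1 * inner F (\<lambda>u. \<bar>f u\<bar>) + (- a / c) * inner F (\<lambda>_. 1)"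
    by (subst (2) F_def, subst inner_add_right) (rule refl)
  also have "inner F (\<lambda>u. \<bar>f u\<bar>) = 1 * inner (\<lambda>u. \<bar>f u\<bar>) (\<lambda>u. \<bar>f u\<bar>) + (- a / c) * a"
    unfolding F_def inner_add_left a_def by (simp add: inner_commute)
  also have "inner (\<lambda>u. \<bar>f u\<bar>) (\<lambda>u. \<bar>f u\<bar>) = 1"
    using assms(4) by (simp add: inner_def mult.assoc)
  finally have FF: "inner F F = 1 - a\<^sup>2 / c" by (simp add: F1 power2_eq_square)
  have "2 * l * inner F F \<le> energy F" by (rule poincare[OF F1])
  also have "energy F = energy (\<lambda>u. \<bar>f u\<bar>)" by (simp add: energy_def F_def)
  also have "\<dots> \<le> 2 * \<epsilon>" using energy_abs_le[of f] assms(5) by simp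
  finally have "2 * ((1 - a\<^sup>2 / c) * l) \<le> 2 * \<epsilon>" by (simp only: FF mult_ac)
  then have "(1 - a\<^sup>2 / c) * l \<le> \<epsilon>" by linarith
  then have "1 - a\<^sup>2 / c \<le> \<epsilon> / l" using \<open>l > 0\<close> by (simp only: pos_le_divide_eq)
  then have "c * (1 - \<epsilon> / l) \<le> c * (a\<^sup>2 / c)" using c by (intro mult_left_mono) auto
  then show ?thesis using c by (simp add: a_def c_def)
qed

end

text \<open>The constant is \<open>4 + 2 * sqrt 2 = 1 + (1 + sqrt 2)\<^sup>2\<close>, from the Cauchy--Schwarz inequality
  applied to \<open>\<bar>x\<bar> + \<bar>y\<bar> + sqrt 2 * max \<bar>x\<bar> \<bar>y\<bar>\<close>.\<close>

lemma four_directions: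
  fixes x y :: real
  shows "(\<bar>x\<bar> + \<bar>y\<bar> + \<bar>1 / sqrt 2 * x + 1 / sqrt 2 * y\<bar> + \<bar>1 / sqrt 2 * x + (- 1 / sqrt 2) * y\<bar>)\<^sup>2
    \<le> (4 + 2 * sqrt 2) * (x\<^sup>2 + y\<^sup>2)"
proof -
  define r where "r = sqrt (2 :: real)"
  have r: "r > 0" "r * r = 2" by (auto simp: r_def)
  have "\<bar>1 / r * x + 1 / r * y\<bar> + \<bar>1 / r * x + (- 1 / r) * y\<bar> = (\<bar>x + y\<bar> + \<bar>x - y\<bar>) / r"
  proof -
    have *: "1 / r * x + 1 / r * y = (x + y) / r" "1 / r * x + (- 1 / r) * y = (x - y) / r"
      by (simp_all add: add_divide_distrib diff_divide_distrib)
    show ?thesis unfolding * abs_divide abs_of_pos[OF r(1)] by (rule add_divide_distrib[symmetric])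
  qed
  also have "\<bar>x + y\<bar> + \<bar>x - y\<bar> = 2 * max \<bar>x\<bar> \<bar>y\<bar>" by (simp add: max_def abs_if)
  also have "2 * max \<bar>x\<bar> \<bar>y\<bar> / r = r * max \<bar>x\<bar> \<bar>y\<bar>" using r by (simp add: field_simps)
  finally have *: "\<bar>x\<bar> + \<bar>y\<bar> + \<bar>1 / r * x + 1 / r * y\<bar> + \<bar>1 / r * x + (- 1 / r) * y\<bar>
      = \<bar>x\<bar> + \<bar>y\<bar> + r * max \<bar>x\<bar> \<bar>y\<bar>" by simp
  have r': "r * (r * z) = 2 * z" for z using r by (simp flip: mult.assoc)
  \<comment> \<open>Here \<open>p\<close> stands for the larger absolute value and \<open>q\<close>
    for the smaller. By Lagrange's identity the defect in Cauchy-Schwarz is a square.\<close>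
  have **: "((1 + r) * p + q)\<^sup>2 \<le> (4 + 2 * r) * (p\<^sup>2 + q\<^sup>2)" for p q
  proof -
    have "(4 + 2 * r) * (p\<^sup>2 + q\<^sup>2) - ((1 + r) * p + q)\<^sup>2 = (p - (1 + r) * q)\<^sup>2"
      using r by (simp add: power2_eq_square algebra_simps r')
    then show ?thesis using zero_le_power2[of "p - (1 + r) * q"] by linarith
  qed
  have "(\<bar>x\<bar> + \<bar>y\<bar> + r * max \<bar>x\<bar> \<bar>y\<bar>)\<^sup>2 \<le> (4 + 2 * r) * (x\<^sup>2 + y\<^sup>2)"
    using **[of "\<bar>x\<bar>" "\<bar>y\<bar>"] **[of "\<bar>y\<bar>" "\<bar>x\<bar>"]
    by (cases "\<bar>x\<bar> \<le> \<bar>y\<bar>") (simp_all add: max_def algebra_simps)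
  then show ?thesis unfolding * unfolding r_def[symmetric] * .
qed

context weighted_graph
begin

text \<open>If the bound failed, the four means would each be at least \<open>sqrt \<kappa>\<close>
  with \<open>16 * \<kappa>\<close> above \<open>c * (8 + 4 * sqrt 2)\<close>, whereas
  Cauchy-Schwarz and \<open>four_directions\<close> keep the square of their sum \<open>T\<close>
  within that value.\<close>

lemma signless_gap:
  assumes V: "V \<noteq> {}" and l: "l > 0"
    and poincare: "\<And>f. inner f (\<lambda>_. 1) = 0 \<Longrightarrow> 2 * l * inner f f \<le> energy f"
    and orth: "inner f f = 1" "inner g g = 1" "inner f g = 0"
    and signless: "\<And>a b. signless_energy (\<lambda>u. a * f u + b * g u) \<le> 2 * \<epsilon> * (a\<^sup>2 + b\<^sup>2)"
  shows "(2 - sqrt 2) / 4 * l \<le> \<epsilon>"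
proof (rule ccontr)
  assume contra: "\<not> ?thesis"
  define c where "c = volume V"
  have c: "c > 0" unfolding c_def by (rule volume_pos[OF V])
  define \<kappa> where "\<kappa> = c * (1 - \<epsilon> / l)"
  have "\<epsilon> / l < (2 - sqrt 2) / 4" using contra l by (simp add: field_simps)
  then have el: "1 - \<epsilon> / l > (2 + sqrt 2) / 4" by argo
  moreover have "(0 :: real) < (2 + sqrt 2) / 4" by (simp add: add_pos_nonneg)
  ultimately have "1 - \<epsilon> / l > 0" by linarith
  then have \<kappa>: "\<kappa> > 0" using c by (simp add: \<kappa>_def)
  define h where "h a b u = \<bar>a * f u + b * g u\<bar>" for a b u
  have lower: "sqrt \<kappa> \<le> inner (h a b) (\<lambda>_. 1)" if ab: "a\<^sup>2 + b\<^sup>2 = 1" for a b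
  proof (rule real_le_lsqrt)
    show "0 \<le> inner (h a b) (\<lambda>_. 1)"
      unfolding inner_def h_def using degree_pos by (auto intro!: sum_nonneg simp: less_imp_le)
    have "inner (\<lambda>u. a * f u + b * g u) (\<lambda>u. a * f u + b * g u) = 1"
      using ab by (simp add: inner_add_left inner_add_right orth inner_commute[of g f] power2_eq_square)
    moreover have "signless_energy (\<lambda>u. a * f u + b * g u) \<le> 2 * \<epsilon>"
      using signless[of a b] ab by simp
    ultimately show "\<kappa> \<le> (inner (h a b) (\<lambda>_. 1))\<^sup>2"
      unfolding \<kappa>_def c_def h_def
    proof (rule inner_abs_one_ge[OF V l, rotated])
      show "2 * l * inner f' f' \<le> energy f'" if "inner f' (\<lambda>_. 1) = 0" for f'
        by (rule poincare[OF that])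
    qed
  qed
  define r where "r = 1 / sqrt (2 :: real)"
  have r: "r\<^sup>2 = 1 / 2" by (simp add: r_def power_divide)
  define X where "X u = h 1 0 u + h 0 1 u + h r r u + h r (- r) u" for u
  define T where "T = inner X (\<lambda>_. 1)"
  have "T = inner (h 1 0) (\<lambda>_. 1) + inner (h 0 1) (\<lambda>_. 1) + inner (h r r) (\<lambda>_. 1) + inner (h r (- r)) (\<lambda>_. 1)"
    unfolding T_def X_def inner_def by (simp add: sum.distrib algebra_simps)
  then have "4 * sqrt \<kappa> \<le> T"
    using lower[of 1 0] lower[of 0 1] lower[of r r] lower[of r "- r"] by (simp add: r)
  then have "(4 * sqrt \<kappa>)\<^sup>2 \<le> T\<^sup>2" using \<kappa> by (intro power_mono) auto
  then have T1: "16 * \<kappa> \<le> T\<^sup>2" using \<kappa> by (simp add: power_mult_distrib)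
  \<comment> \<open>Cauchy-Schwarz against the constant function, read off from the squared norm of
    \<open>c * X - T\<close>.\<close>
  have "0 \<le> inner (\<lambda>u. c * X u + (- T) * 1) (\<lambda>u. c * X u + (- T) * 1)"
    by (rule inner_self_nonneg)
  also have "\<dots> = c * (c * inner X X - T\<^sup>2)"
    unfolding inner_add_left inner_add_right inner_one inner_commute[of "\<lambda>_. 1" X]
    by (simp add: T_def[symmetric] c_def[symmetric] power2_eq_square algebra_simps)
  finally have T2: "T\<^sup>2 \<le> c * inner X X" using c by (simp add: zero_le_mult_iff)
  have "inner X X = (\<Sum>u\<in>V. d u * (X u)\<^sup>2)" by (simp add: inner_def power2_eq_square mult.assoc)
  also have "\<dots> \<le> (\<Sum>u\<in>V. d u * ((4 + 2 * sqrt 2) * ((f u)\<^sup>2 + (g u)\<^sup>2)))"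
    using degree_pos four_directions
    by (intro sum_mono mult_left_mono) (auto simp: X_def h_def r_def less_imp_le)
  also have "\<dots> = (4 + 2 * sqrt 2) * (inner f f + inner g g)"
    unfolding inner_def sum.distrib[symmetric] sum_distrib_left
    by (intro sum.cong refl) (simp add: power2_eq_square algebra_simps)
  finally have "c * inner X X \<le> c * (8 + 4 * sqrt 2)" using c orth by simp
  then have "16 * (c * (1 - \<epsilon> / l)) \<le> c * (8 + 4 * sqrt 2)" using T1 T2 by (simp add: \<kappa>_def)
  then have "16 * (1 - \<epsilon> / l) \<le> 8 + 4 * sqrt 2" using c by (simp add: mult.left_commute)
  then show False using el by argo
qed

end

section \<open>Spectral bounds from an eigenbasis\<close>

subsection \<open>Consequences of an eigenbasis\<close>

text \<open>Eigenvalues are numbered from 0 in decreasing order: \<open>\<mu> 1\<close> is the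
  second largest, \<open>\<mu> (n - 2)\<close> the second smallest and \<open>\<mu> (n - 1)\<close>
  the smallest.\<close>

locale weighted_graph_eigenbasis = weighted_graph +
  fixes n :: nat and e :: "nat \<Rightarrow> 'a \<Rightarrow> real" and \<mu> :: "nat \<Rightarrow> real"
  assumes two_le: "2 \<le> n"
    and orthonormal: "\<lbrakk>k < n; l < n\<rbrakk> \<Longrightarrow> inner (e k) (e l) = (if k = l then 1 else 0)"
    and eigen: "\<lbrakk>k < n; u \<in> V\<rbrakk> \<Longrightarrow> (\<Sum>v\<in>V. w u v * e k v) = \<mu> k * d u * e k u"
    and complete: "u \<in> V \<Longrightarrow> f u = (\<Sum>k<n. inner f (e k) * e k u)"
    and decreasing: "\<lbrakk>k \<le> l; l < n\<rbrakk> \<Longrightarrow> \<mu> l \<le> \<mu> k"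
begin

lemma adj_form_eigen:
  assumes "k < n"
  shows "adj_form f (e k) = \<mu> k * inner f (e k)"
proof -
  have "adj_form f (e k) = (\<Sum>u\<in>V. f u * (\<Sum>v\<in>V. w u v * e k v))"
    by (simp add: adj_form_def sum_distrib_left mult_ac)
  also have "\<dots> = (\<Sum>u\<in>V. f u * (\<mu> k * d u * e k u))"
    using assms by (intro sum.cong) (simp_all add: eigen)
  also have "\<dots> = \<mu> k * inner f (e k)"
    by (simp add: inner_def sum_distrib_left mult_ac)
  finally show ?thesis .
qed

text \<open>Parseval's identity: the expansion is substituted for only one of the two
  factors.\<close>

lemma inner_complete: "inner f f = (\<Sum>k<n. (inner f (e k))\<^sup>2)"
proof -
  have "inner f f = (\<Sum>u\<in>V. d u * f u * (\<Sum>k<n. inner f (e k) * e k u))"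
    unfolding inner_def[of f f] by (intro sum.cong refl) (simp flip: complete)
  also have "\<dots> = (\<Sum>k<n. \<Sum>u\<in>V. inner f (e k) * (d u * f u * e k u))"
    unfolding sum_distrib_left by (subst sum.swap) (simp add: mult_ac)
  also have "\<dots> = (\<Sum>k<n. (inner f (e k))\<^sup>2)"
    unfolding sum_distrib_left[symmetric] inner_def[symmetric] by (simp add: power2_eq_square)
  finally show ?thesis .
qed

lemma adj_form_complete: "adj_form f f = (\<Sum>k<n. \<mu> k * (inner f (e k))\<^sup>2)"
proof -
  have "adj_form f f = (\<Sum>u\<in>V. \<Sum>v\<in>V. w u v * f u * (\<Sum>k<n. inner f (e k) * e k v))"
    unfolding adj_form_def by (intro sum.cong refl) (simp flip: complete)
  also have "\<dots> = (\<Sum>u\<in>V. \<Sum>v\<in>V. \<Sum>k<n. inner f (e k) * (w u v * f u * e k v))"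
    unfolding sum_distrib_left by (simp add: mult_ac)
  also have "\<dots> = (\<Sum>k<n. \<Sum>u\<in>V. \<Sum>v\<in>V. inner f (e k) * (w u v * f u * e k v))"
    by (subst (2) sum.swap, subst sum.swap) (rule refl)
  also have "\<dots> = (\<Sum>k<n. inner f (e k) * adj_form f (e k))"
    by (simp only: sum_distrib_left[symmetric] adj_form_def)
  also have "\<dots> = (\<Sum>k<n. \<mu> k * (inner f (e k))\<^sup>2)"
    by (simp add: adj_form_eigen power2_eq_square mult_ac)
  finally show ?thesis .
qed

lemma eigenvalue_le_1: "k < n \<Longrightarrow> \<mu> k \<le> 1"
  using energy_nonneg[of "e k"] by (simp add: energy_eq adj_form_eigen orthonormal)

lemma nonempty: "V \<noteq> {}"
  using orthonormal[of 0 0] two_le by (auto simp: inner_def)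

text \<open>The spectral expansions of \<open>adj_form\<close> and \<open>inner\<close> are compared
  term by term; only \<open>k = 0\<close> can cause trouble. When \<open>\<mu> 1 < 1\<close>, the
  constant function is a multiple of \<open>e 0\<close>, so \<open>f\<close> has no component
  there.\<close>

theorem poincare:
  assumes f: "inner f (\<lambda>_. 1) = 0"
  shows "2 * (1 - \<mu> 1) * inner f f \<le> energy f"
proof -
  have "\<mu> k * (inner f (e k))\<^sup>2 \<le> \<mu> 1 * (inner f (e k))\<^sup>2" if k: "k < n" for k
  proof (cases "k \<ge> 1 \<or> \<mu> 1 = 1")
    case True
    then have "\<mu> k \<le> \<mu> 1" using decreasing[of 1 k] eigenvalue_le_1[OF k] k by auto
    then show ?thesis by (intro mult_right_mono) auto
  next
    case False
    then have "k = 0" and lt: "\<mu> 1 < 1" using eigenvalue_le_1[of 1] two_le by auto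
    have "inner (\<lambda>_. 1) (e l) = 0" if l: "l \<in> {..<n} - {0}" for l
    proof -
      \<comment> \<open>Row sums of \<open>w\<close> are the degrees, so constants have eigenvalue 1
        and are orthogonal to every \<open>e l\<close> with a smaller eigenvalue.\<close>
      have "\<mu> l * inner (\<lambda>_. 1) (e l) = (\<Sum>u\<in>V. \<Sum>v\<in>V. w u v * e l v)"
        using l adj_form_eigen[of l "\<lambda>_. 1"] by (simp add: adj_form_def)
      also have "\<dots> = inner (\<lambda>_. 1) (e l)" by (simp add: double_sum_degree inner_def)
      finally have "(1 - \<mu> l) * inner (\<lambda>_. 1) (e l) = 0" by (simp add: algebra_simps)
      moreover have "\<mu> l < 1" using decreasing[of 1 l] lt l by auto
      ultimately show ?thesis by simp
    qed
    moreover have "(0 :: nat) \<in> {..<n}" using two_le by simp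
    ultimately have one: "1 = inner (\<lambda>_. 1) (e 0) * e 0 u" if "u \<in> V" for u
      using complete[OF that, of "\<lambda>_. 1"] by (subst (asm) sum.remove[of _ 0]) auto
    \<comment> \<open>The zero summand only gives the shape required by
      \<open>inner_add_right\<close>.\<close>
    have "0 = inner f (\<lambda>u. inner (\<lambda>_. 1) (e 0) * e 0 u + 0 * e 0 u)"
      using f one by (simp add: inner_def)
    also have "\<dots> = inner (\<lambda>_. 1) (e 0) * inner f (e 0)"
      unfolding inner_add_right by simp
    finally have "inner f (e 0) = 0" using one nonempty by fastforce
    then show ?thesis using \<open>k = 0\<close> by simp
  qed
  then have "adj_form f f \<le> \<mu> 1 * inner f f"
    unfolding adj_form_complete inner_complete sum_distrib_left by (intro sum_mono) auto
  then show ?thesis by (simp add: energy_eq algebra_simps)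
qed

lemma adj_form_pair:
  assumes "k < n" "l < n" "k \<noteq> l"
  shows "inner (\<lambda>u. a * e k u + b * e l u) (\<lambda>u. a * e k u + b * e l u) = a\<^sup>2 + b\<^sup>2"
    and "adj_form (\<lambda>u. a * e k u + b * e l u) (\<lambda>u. a * e k u + b * e l u) = a\<^sup>2 * \<mu> k + b\<^sup>2 * \<mu> l"
  using assms
  by (simp_all add: inner_add_left inner_add_right adj_form_add_left adj_form_add_right
      orthonormal adj_form_eigen power2_eq_square mult_ac)

text \<open>The span of \<open>e 0\<close> and \<open>e 1\<close> is two-dimensional, so it meets
  the orthogonal complement of the constants nontrivially, and there the Rayleigh quotient of
  \<open>adj_form\<close> is at least \<open>\<mu> 1\<close>. Applying \<open>cheeger\<close> to
  this function bounds the expansion by the spectral gap.\<close>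

lemma test_function:
  obtains f where "inner f (\<lambda>_. 1) = 0" "inner f f > 0" "energy f \<le> 2 * (1 - \<mu> 1) * inner f f"
proof -
  obtain a b where ab: "a * inner (e 0) (\<lambda>_. 1) + b * inner (e 1) (\<lambda>_. 1) = 0" "a\<^sup>2 + b\<^sup>2 > 0"
  proof (cases "inner (e 0) (\<lambda>_. 1) = 0")
    case True
    then show ?thesis using that[of 1 0] by simp
  next
    case False
    then show ?thesis using that[of "- inner (e 1) (\<lambda>_. 1)" "inner (e 0) (\<lambda>_. 1)"]
      by (simp add: sum_power2_gt_zero_iff)
  qed
  define f where "f = (\<lambda>u. a * e 0 u + b * e 1 u)"
  have ff: "inner f f = a\<^sup>2 + b\<^sup>2" "adj_form f f = a\<^sup>2 * \<mu> 0 + b\<^sup>2 * \<mu> 1"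
    unfolding f_def using two_le by (auto intro!: adj_form_pair)
  have "a\<^sup>2 * \<mu> 1 \<le> a\<^sup>2 * \<mu> 0" using decreasing[of 0 1] two_le by (intro mult_left_mono) auto
  then have "energy f \<le> 2 * (1 - \<mu> 1) * inner f f" by (simp add: energy_eq ff algebra_simps)
  moreover have "inner f (\<lambda>_. 1) = 0" using ab(1) by (simp add: f_def inner_add_left)
  ultimately show ?thesis using that ab(2) ff(1) by simp
qed

lemma cheeger_eigenvalue:
  assumes "h \<ge> 0" "\<And>S. \<lbrakk>S \<subseteq> V; 2 * volume S \<le> volume V\<rbrakk> \<Longrightarrow> h * volume S \<le> boundary_weight S"
  shows "h\<^sup>2 \<le> 2 * (1 - \<mu> 1)"
proof -
  obtain f where f: "inner f (\<lambda>_. 1) = 0" "inner f f > 0" "energy f \<le> 2 * (1 - \<mu> 1) * inner f f"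
    using test_function .
  have "h\<^sup>2 * inner f f \<le> 2 * (1 - \<mu> 1) * inner f f"
    using cheeger[OF nonempty assms f(1)] f(3) by simp
  then show ?thesis using f(2) by simp
qed

lemma second_smallest_eigenvalue:
  assumes "\<mu> 1 < 1"
  shows "(2 - sqrt 2) / 4 * (1 - \<mu> 1) \<le> 1 + \<mu> (n - 2)"
proof (rule signless_gap[OF nonempty, of _ "e (n - 2)" "e (n - 1)"])
  have n: "n - 2 < n" "n - 1 < n" "n - 2 \<noteq> n - 1" using two_le by auto
  show "signless_energy (\<lambda>u. a * e (n - 2) u + b * e (n - 1) u) \<le> 2 * (1 + \<mu> (n - 2)) * (a\<^sup>2 + b\<^sup>2)" for a b
  proof -
    \<comment> \<open>On the span of the last two eigenfunctions the larger of the two eigenvalues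
      governs the signless energy.\<close>
    have "b\<^sup>2 * \<mu> (n - 1) \<le> b\<^sup>2 * \<mu> (n - 2)"
      using decreasing[of "n - 2" "n - 1"] two_le by (intro mult_left_mono) auto
    then show ?thesis
      unfolding signless_energy_eq adj_form_pair[OF n] by (simp add: algebra_simps)
  qed
  show "inner (e (n - 2)) (e (n - 2)) = 1" "inner (e (n - 1)) (e (n - 1)) = 1"
    "inner (e (n - 2)) (e (n - 1)) = 0" using n by (simp_all add: orthonormal)
qed (use assms poincare in auto)

theorem second_smallest_eigenvalue_expansion:
  assumes "h \<ge> 0" "\<And>S. \<lbrakk>S \<subseteq> V; 2 * volume S \<le> volume V\<rbrakk> \<Longrightarrow> h * volume S \<le> boundary_weight S"
  shows "(1 - \<mu> 1)\<^sup>2 / (2 * h\<^sup>2) * (sqrt (1 + h\<^sup>2 / (1 - \<mu> 1)) - 1)\<^sup>2 \<le> 1 + \<mu> (n - 2)"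
proof (cases "h = 0 \<or> \<mu> 1 = 1")
  \<comment> \<open>Degenerate case: the left side is 0, through division by zero if
    \<open>h = 0\<close>, so nonnegativity of the signless energy suffices.\<close>
  case True
  have "signless_energy (e (n - 2)) \<ge> 0" by (rule signless_energy_nonneg)
  then have "1 + \<mu> (n - 2) \<ge> 0"
    using two_le by (simp add: signless_energy_eq adj_form_eigen orthonormal)
  then show ?thesis using True by auto
next
  case False
  define l where "l = 1 - \<mu> 1"
  have "\<mu> 1 < 1" using False eigenvalue_le_1[of 1] two_le by auto
  then have l: "l > 0" and h: "h > 0" using False assms(1) by (auto simp: l_def)
  define t where "t = sqrt (1 + h\<^sup>2 / l) - 1"
  have t: "t > 0" using l h by (simp add: t_def)
  have "(t + 1)\<^sup>2 = 1 + h\<^sup>2 / l" using l by (simp add: t_def)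
  \<comment> \<open>This substitution removes the square root: the bound becomes
    \<open>t / (2 * (t + 2)) * l\<close>.\<close>
  then have h2: "h\<^sup>2 = l * (t * (t + 2))" using l by (simp add: field_simps power2_eq_square)
  have "h\<^sup>2 \<le> 2 * l" using cheeger_eigenvalue[OF assms] by (simp add: l_def)
  then have "t * (t + 2) \<le> 2" using l by (simp add: h2)
  \<comment> \<open>A rational substitute for the bound \<open>sqrt 3 - 1\<close>; at 3/4 the
    product \<open>t * (t + 2)\<close> is already 33/16.\<close>
  have "t \<le> 3 / 4"
  proof (rule ccontr)
    assume "\<not> ?thesis"
    then have "(3 / 4) * (11 / 4) < t * (t + 2)" by (intro mult_strict_mono) auto
    then show False using \<open>t * (t + 2) \<le> 2\<close> by simp
  qed
  \<comment> \<open>The value 10/7 turns \<open>(2 - sqrt 2) / 4\<close> into the lower bound 1/7,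
    which also bounds \<open>t / (2 * (t + 2))\<close> from above.\<close>
  have sqrt2: "sqrt 2 \<le> 10 / (7 :: real)" by (rule real_le_lsqrt) (auto simp: power2_eq_square)
  have t2: "t + 2 \<noteq> 0" using t by simp
  have "(1 - \<mu> 1)\<^sup>2 / (2 * h\<^sup>2) * (sqrt (1 + h\<^sup>2 / (1 - \<mu> 1)) - 1)\<^sup>2 = t / (2 * (t + 2)) * l"
    unfolding l_def[symmetric] unfolding t_def[symmetric] unfolding h2
    using l t t2 by (simp add: divide_simps power2_eq_square)
  also have "\<dots> \<le> (2 - sqrt 2) / 4 * l"
  proof (rule mult_right_mono)
    have "t / (2 * (t + 2)) \<le> 1 / 7" using t \<open>t \<le> 3 / 4\<close> by (simp add: divide_simps)
    also have "\<dots> \<le> (2 - sqrt 2) / 4" using sqrt2 by simp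
    finally show "t / (2 * (t + 2)) \<le> (2 - sqrt 2) / 4" .
  qed (use l in simp)
  also have "\<dots> \<le> 1 + \<mu> (n - 2)"
    using second_smallest_eigenvalue \<open>\<mu> 1 < 1\<close> by (simp add: l_def)
  finally show ?thesis .
qed

end

section \<open>Transfer to simple graphs and their matrices\<close>

section \<open>The normalized adjacency matrix of a graph\<close>

text \<open>Sending a neighbour \<open>v\<close> to the edge \<open>{u, v}\<close> is a bijection
  from neighbours of \<open>u\<close> to edges at \<open>u\<close>.\<close>

lemma vertex_degree_sum:
  assumes G: "simple_graph V E" and u: "u \<in> V"
  shows "real (vertex_degree E u) = (\<Sum>v\<in>V. of_bool ({u, v} \<in> E))"
proof -
  have "{e \<in> E. u \<in> e} = (\<lambda>v. {u, v}) ` {v \<in> V. {u, v} \<in> E}"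
  proof (intro equalityI subsetI)
    fix e assume e: "e \<in> {e \<in> E. u \<in> e}"
    then obtain x y where "e = {x, y}" "e \<subseteq> V"
      using G unfolding simple_graph_def by (metis (no_types, lifting) card_2_iff mem_Collect_eq)
    then show "e \<in> (\<lambda>v. {u, v}) ` {v \<in> V. {u, v} \<in> E}"
      using e by (auto simp: insert_commute)
  qed auto
  moreover have "inj_on (\<lambda>v. {u, v}) {v \<in> V. {u, v} \<in> E}"
    by (auto intro!: inj_onI simp: doubleton_eq_iff)
  ultimately have "vertex_degree E u = card {v \<in> V. {u, v} \<in> E}"
    by (simp add: vertex_degree_def card_image)
  then show ?thesis using G by (simp add: simple_graph_def sum.If_cases of_bool_def Int_def)
qed

text \<open>Each boundary edge has exactly one ordering that starts in \<open>S\<close>, so counting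
  ordered pairs counts it once.\<close>

lemma card_edge_boundary:
  assumes G: "simple_graph V E" and S: "S \<subseteq> V"
  shows "real (card (edge_boundary E S)) = (\<Sum>u\<in>S. \<Sum>v\<in>V - S. of_bool ({u, v} \<in> E))"
proof -
  have fin: "finite V" "finite S" using G S finite_subset by (auto simp: simple_graph_def)
  define P where "P = {(u, v). u \<in> S \<and> v \<in> V - S \<and> {u, v} \<in> E}"
  have "edge_boundary E S = (\<lambda>(u, v). {u, v}) ` P"
  proof (intro equalityI subsetI)
    fix e assume "e \<in> edge_boundary E S"
    then obtain i j where "e \<in> E" "e = {i, j}" "i \<in> S" "j \<notin> S" by (auto simp: edge_boundary_def)
    moreover from this have "j \<in> V" using G by (auto simp: simple_graph_def)
    ultimately show "e \<in> (\<lambda>(u, v). {u, v}) ` P" by (auto simp: P_def intro!: image_eqI[of _ _ "(i, j)"])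
  qed (auto simp: edge_boundary_def P_def)
  moreover have "inj_on (\<lambda>(u, v). {u, v}) P"
    by (auto intro!: inj_onI simp: P_def doubleton_eq_iff)
  ultimately have "card (edge_boundary E S) = card P" by (simp add: card_image)
  also have "P = {p \<in> S \<times> (V - S). {fst p, snd p} \<in> E}" by (auto simp: P_def)
  also have "real (card \<dots>) = (\<Sum>(u, v)\<in>S \<times> (V - S). of_bool ({u, v} \<in> E))"
    using fin by (simp add: of_bool_def case_prod_beta sum.If_cases Int_def)
  finally show ?thesis by (simp add: sum.cartesian_product)
qed

lemma two_le_card:
  assumes "simple_graph V E"
  shows "2 \<le> card V"
proof -
  from assms obtain u where "u \<in> V" "vertex_degree E u \<noteq> 0" by (auto simp: simple_graph_def)
  then have "{e \<in> E. u \<in> e} \<noteq> {}" unfolding vertex_degree_def by (metis card.empty)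
  then obtain e where "e \<in> E" by blast
  then have "e \<subseteq> V" "card e = 2" "finite V" using assms by (auto simp: simple_graph_def)
  then show ?thesis using card_mono by metis
qed

lemma normalized_adj_matrix_eq:
  "normalized_adj_matrix E vs = mat (length vs) (length vs)
     (\<lambda>(i, j). inverse (real (vertex_degree E (vs ! i))) * of_bool ({vs ! i, vs ! j} \<in> E))"
  unfolding normalized_adj_matrix_def inv_degree_matrix_def
  by (subst mat_diag_mult_left[of _ _ "length vs"]) (auto simp: adj_matrix_def)

theorem theorem1:
  fixes V :: "'a set" and E :: "'a set set" and vs :: "'a list"
  assumes "simple_graph V E" and "connected_graph V E"
    and "distinct vs" and "set vs = V"
  shows "let n = card V;
             \<mu> = eigval (normalized_adj_matrix E vs);
             h = edge_expansion V E
         in 1 + \<mu> (n - 1)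
              \<ge> (1 - \<mu> 2)\<^sup>2 / (2 * h\<^sup>2) * (sqrt (1 + h\<^sup>2 / (1 - \<mu> 2)) - 1)\<^sup>2"
proof -
  note G = assms(1)
  define n where "n = card V"
  have len: "length vs = n" using assms(3,4) distinct_card n_def by fastforce
  have finV: "finite V" and n2: "2 \<le> n"
    using G two_le_card[OF G] by (auto simp: simple_graph_def n_def)
  define w where "w u v = (of_bool ({u, v} \<in> E) :: real)" for u v
  define d where "d u = real (vertex_degree E u)" for u
  define \<mu> where "\<mu> = eigenvalue_list (normalized_adj_matrix E vs)"
  have w_sym: "w u v = w v u" for u v by (simp add: w_def insert_commute)
  have d_pos: "d u > 0" if "u \<in> V" for u using G that by (simp add: simple_graph_def d_def)
  have vsV: "vs ! i \<in> V" if "i < n" for i using that len assms(4) by auto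
  have reindex: "(\<Sum>v\<in>V. f v) = (\<Sum>i<n. f (vs ! i))" for f :: "'a \<Rightarrow> real"
    using sum.reindex_bij_betw[OF bij_betw_nth[OF assms(3) _ assms(4)[symmetric]], of "{..<n}" f] len
    by simp
  interpret weighted_graph V w d
    by unfold_locales
      (use finV w_sym d_pos vertex_degree_sum[OF G] in \<open>auto simp: w_def d_def\<close>)
  have M: "normalized_adj_matrix E vs = mat n n (\<lambda>(i, j). inverse (d (vs ! i)) * w (vs ! i) (vs ! j))"
    by (simp add: normalized_adj_matrix_eq len w_def d_def)
  obtain e where e: "length \<mu> = n" "sorted (rev \<mu>)"
    "\<And>k l. \<lbrakk>k < n; l < n\<rbrakk> \<Longrightarrow> (\<Sum>i<n. d (vs ! i) * e k i * e l i) = (if k = l then 1 else 0)"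
    "\<And>k i. \<lbrakk>k < n; i < n\<rbrakk> \<Longrightarrow> (\<Sum>j<n. w (vs ! i) (vs ! j) * e k j) = \<mu> ! k * d (vs ! i) * e k i"
    "\<And>i j. \<lbrakk>i < n; j < n\<rbrakk> \<Longrightarrow> d (vs ! j) * (\<Sum>k<n. e k i * e k j) = (if i = j then 1 else 0)"
    using weighted_eigenbasis[of "\<lambda>i j. w (vs ! i) (vs ! j)" n "\<lambda>i. d (vs ! i)",
        OF w_sym d_pos[OF vsV], folded M, folded \<mu>_def]
    by blast
  \<comment> \<open>The inverse of the enumeration turns vectors indexed by numbers into functions
    on \<open>V\<close>.\<close>
  define idx where "idx = the_inv_into {..<n} ((!) vs)"
  have "inj_on ((!) vs) {..<n}" using assms(3) len by (auto intro!: inj_on_nth)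
  then have idx: "idx (vs ! i) = i" if "i < n" for i
    unfolding idx_def using that by (intro the_inv_into_f_f) auto
  define b where "b k v = e k (idx v)" for k v
  have nth: "\<exists>i<n. u = vs ! i" if "u \<in> V" for u
    using that assms(4) len by (auto simp: in_set_conv_nth)
  have b_nth: "b k (vs ! i) = e k i" if "i < n" for k i using idx[OF that] by (simp add: b_def)
  interpret weighted_graph_eigenbasis V w d n b "(!) \<mu>"
  proof
    show "2 \<le> n" by (rule n2)
    show "inner (b k) (b l) = (if k = l then 1 else 0)" if "k < n" "l < n" for k l
      using e(3)[OF that] by (simp add: inner_def reindex b_nth)
    show "(\<Sum>v\<in>V. w u v * b k v) = \<mu> ! k * d u * b k u" if "k < n" "u \<in> V" for k u
      using nth[OF that(2)] e(4)[OF that(1)] by (auto simp: reindex b_nth)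
    show "f u = (\<Sum>k<n. inner f (b k) * b k u)" if u: "u \<in> V" for f u
    proof -
      obtain i where i: "i < n" "u = vs ! i" using nth[OF u] by blast
      \<comment> \<open>Exchanging the sums exposes the dual orthogonality relation
        \<open>e(5)\<close>, which leaves only the term at \<open>u\<close>.\<close>
      have "(\<Sum>k<n. inner f (b k) * b k u)
          = (\<Sum>k<n. \<Sum>j<n. f (vs ! j) * (d (vs ! j) * (e k i * e k j)))"
        using i by (simp add: inner_def reindex b_nth sum_distrib_left mult_ac)
      also have "\<dots> = (\<Sum>j<n. f (vs ! j) * (d (vs ! j) * (\<Sum>k<n. e k i * e k j)))"
        by (subst sum.swap) (simp only: sum_distrib_left)
      also have "\<dots> = (\<Sum>j<n. if i = j then f (vs ! j) else 0)"
        using e(5)[OF i(1)] by (intro sum.cong refl) auto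
      also have "\<dots> = f u" using i by simp
      finally show ?thesis by simp
    qed
    show "\<mu> ! l \<le> \<mu> ! k" if "k \<le> l" "l < n" for k l
      using sorted_rev_nth_mono[OF e(2)] that e(1) by simp
  qed
  define h where "h = edge_expansion V E"
  have fin: "finite (set_expansion V E ` {S. S \<noteq> {} \<and> S \<subset> V})"
    by (intro finite_imageI finite_subset[OF _ finite_Pow_iff[THEN iffD2, OF finV]]) auto
  have "h \<ge> 0"
  proof -
    obtain u where u: "u \<in> V" using nonempty by blast
    moreover have "{u} \<noteq> V" using n2 by (auto simp: n_def)
    ultimately have "{u} \<in> {S. S \<noteq> {} \<and> S \<subset> V}" by auto
    then have "h \<in> set_expansion V E ` {S. S \<noteq> {} \<and> S \<subset> V}"
      unfolding h_def edge_expansion_def using fin by (intro Min_in) blast+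
    then show ?thesis by (auto simp: set_expansion_def)
  qed
  have vol: "real (vol E S) = volume S" for S
    by (simp add: vol_def volume_def d_def)
  have "h * volume S \<le> boundary_weight S" if S: "S \<subseteq> V" "2 * volume S \<le> volume V" for S
  \<comment> \<open>The minimum defining \<open>h\<close> omits the empty set and \<open>V\<close>.
    The former is trivial, the latter is excluded by its volume, and otherwise the denominator of
    \<open>set_expansion\<close> is \<open>volume S\<close>.\<close>
  proof (cases "S = {}")
    case True
    then show ?thesis by (simp add: volume_def boundary_weight_def)
  next
    case False
    have "volume S > 0"
      unfolding volume_def using d_pos S finV False finite_subset by (intro sum_pos) auto
    moreover have "S \<noteq> V" using S(2) calculation by auto
    moreover have "set_expansion V E S = boundary_weight S / volume S"
      using S(2) volume_Diff[OF S(1)] unfolding set_expansion_def of_nat_min vol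
      by (simp add: card_edge_boundary[OF G S(1)] boundary_weight_def w_def min_def)
    moreover have "h \<le> set_expansion V E S"
      unfolding h_def edge_expansion_def using fin S(1) False \<open>S \<noteq> V\<close> by (intro Min_le) auto
    ultimately show ?thesis by (simp add: pos_le_divide_eq)
  qed
  \<comment> \<open>Index shift: \<open>eigval\<close> counts from 1, so its arguments 2 and
    \<open>n - 1\<close> are the list positions 1 and \<open>n - 2\<close>.\<close>
  from second_smallest_eigenvalue_expansion[OF \<open>h \<ge> 0\<close> this] show ?thesis
    unfolding Let_def eigval_def n_def[symmetric] h_def[symmetric] \<mu>_def[symmetric]
    by (simp add: numeral_2_eq_2)
qed

end
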